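(* Let $(\mathcal{A}_1,\varphi_1,\psi_1)$ and $(\mathcal{A}_2,\varphi_2,\psi_2)$ be unital algebras, each equipped with two states, and let $\widetilde{\mathcal{A}}_1=\mathcal{A}_1(P)$, $\widetilde{\mathcal{A}}_2=\mathcal{A}_2(Q)$ be their extensions, with extended states $\widetilde\varphi_1,\widetilde\psi_1$ on $\widetilde{\mathcal{A}}_1$ and $\widetilde\varphi_2,\widetilde\psi_2$ on $\widetilde{\mathcal{A}}_2$. On the tensor product algebra $\mathcal{A}=\widetilde{\mathcal{A}}_1\otimes\widetilde{\mathcal{A}}_2\otimes\widetilde{\mathcal{A}}_2$ consider the product states $$\varphi=\widetilde\varphi_1\otimes\widetilde\varphi_2\otimes\widetilde\psi_2,\qquad \psi=\widetilde\psi_1\otimes\widetilde\psi_2\otimes\widetilde\psi_2 .$$ Let $j_i:\mathcal{A}_i\to\mathcal{A}$, $i=1,2$, be the homomorphisms given by $j_i(a_i)=A_i$, where $$A_1=a_1\otimes Q\otimes Q,\qquad A_2=P\otimes a_2\otimes 1_2+P^{\perp}\otimes 1_2\otimes a_2$$ for $a_i\in\mathcal{A}_i$. Then $\varphi\circ j_i=\varphi_i$ and $\psi\circ j_i=\psi_i$ for $i=1,2$, and the subalgebras of $\mathcal{A}$ generated by the elements $A_1$ ($a_1\in\mathcal{A}_1$) and by the elements $A_2$ ($a_2\in\mathcal{A}_2$), respectively, are c-monotone independent with respect to $(\varphi,\psi)$ (index set $\{1,2\}$ with $1<2$).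
   Context: Algebras are complex and unital, with $1_i$ the unit of $\mathcal{A}_i$. A state on a unital algebra is a linear functional taking the value $1$ at the unit (if the algebra is a $*$-algebra, it is also required to be positive). Homomorphisms are not required to be unital, and subalgebras are not required to contain the unit of the ambient algebra. Extension. For a unital algebra $\mathcal{B}$ with state $\varphi$, $\widetilde{\mathcal{B}}=\mathcal{B}(P)$ is the unital algebra generated by $\mathcal{B}$ and an indeterminate $P$ subject to $1P=P1=P^2=P$, where $1$ is the unit of $\mathcal{B}$ (and $P^*=P$ in the $*$-case). The extended state $\widetilde\varphi:\widetilde{\mathcal{B}}\to\mathbb{C}$ is the linear functional determined by $\widetilde\varphi(P)=1$ and $$\widetilde\varphi(P^{\alpha}b_1Pb_2P\cdots Pb_nP^{\beta})=\varphi(b_1)\varphi(b_2)\cdots\varphi(b_n),\quad \alpha,\beta\in\{0,1\},\ b_1,\dots,b_n\in\mathcal{B}.$$ For $\widetilde{\mathcal{A}}_2$ the indeterminate is called $Q$. $P^{\perp}=1-P$. Monotone independence. Subalgebras $\{\mathcal{B}_j:j\in J\}$ of a unital algebra $\mathcal{B}$, $J$ linearly ordered, are monotone independent with respect to a state $\psi$ if $$\psi(b_1\cdots b_n)=\psi(b_i)\,\psi(b_1\cdots b_{i-1}b_{i+1}\cdots b_n)$$ whenever $b_k\in\mathcal{B}_{j_k}$, $j_1\neq j_2\neq\cdots\neq j_n$, and $j_{i-1}<j_i>j_{i+1}$, where for $i=1$ or $i=n$ only the right or left inequality, respectively, is required. c-monotone independence. Subalgebras $\{\mathcal{B}_j:j\in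 J\}$, $J$ linearly ordered, of a unital algebra with two states $\varphi,\psi$ are c-monotone independent with respect to $(\varphi,\psi)$ if they are monotone independent with respect to $\psi$ and $$\varphi(b_1\cdots b_n)=(\varphi(b_i)-\psi(b_i))\,\varphi(b_1\cdots b_{i-1})\,\varphi(b_{i+1}\cdots b_n)+\psi(b_i)\,\varphi(b_1\cdots b_{i-1}b_{i+1}\cdots b_n)$$ for any $b_k\in\mathcal{B}_{j_k}$ with $j_{i-1}<j_i>j_{i+1}$, where for $i=1$ or $i=n$ only the right or left inequality, respectively, is required, and states evaluated at empty products equal $1$. *)

theory Defs
  imports Complex_Main
begin

section \<open>Unital complex algebras and states\<close>

class scaleC =
  fixes scaleC :: "complex \<Rightarrow> 'a \<Rightarrow> 'a"  (infixr "*\<^sub>C" 75)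

text \<open>The class \<^class>\<open>ring_1\<close> includes \<open>0 \<noteq> 1\<close>. This excludes only the zero algebra, which
  carries no functional with value 1 at the unit.\<close>

class complex_algebra_1 = ring_1 + scaleC +
  assumes scaleC_add_right: "c *\<^sub>C (x + y) = c *\<^sub>C x + c *\<^sub>C y"
    and scaleC_add_left: "(c + d) *\<^sub>C x = c *\<^sub>C x + d *\<^sub>C x"
    and scaleC_scaleC: "c *\<^sub>C (d *\<^sub>C x) = (c * d) *\<^sub>C x"
    and scaleC_one: "1 *\<^sub>C x = x"
    and mult_scaleC_left: "(c *\<^sub>C x) * y = c *\<^sub>C (x * y)"
    and mult_scaleC_right: "x * (c *\<^sub>C y) = c *\<^sub>C (x * y)"

global_interpretation calg: vector_space "scaleC :: complex \<Rightarrow> 'a \<Rightarrow> 'a::complex_algebra_1"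
  by unfold_locales
    (simp_all add: scaleC_add_right scaleC_add_left scaleC_scaleC scaleC_one)

abbreviation clinear :: "('a::complex_algebra_1 \<Rightarrow> 'b::complex_algebra_1) \<Rightarrow> bool"
  where "clinear \<equiv> Vector_Spaces.linear scaleC scaleC"

abbreviation cfunctional :: "('a::complex_algebra_1 \<Rightarrow> complex) \<Rightarrow> bool"
  where "cfunctional \<equiv> Vector_Spaces.linear scaleC (*)"

definition is_state :: "('a::complex_algebra_1 \<Rightarrow> complex) \<Rightarrow> bool"
  where "is_state \<phi> \<longleftrightarrow> cfunctional \<phi> \<and> \<phi> 1 = 1"

definition alg_hom :: "('a::complex_algebra_1 \<Rightarrow> 'b::complex_algebra_1) \<Rightarrow> bool"
  where "alg_hom h \<longleftrightarrow> clinear h \<and> (\<forall>x y. h (x * y) = h x * h y)"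

text \<open>Subalgebras need not contain the unit.\<close>

definition subalgebra :: "'a::complex_algebra_1 set \<Rightarrow> bool"
  where "subalgebra B \<longleftrightarrow> calg.subspace B \<and> (\<forall>x\<in>B. \<forall>y\<in>B. x * y \<in> B)"

definition generated_subalgebra :: "'a::complex_algebra_1 set \<Rightarrow> 'a set"
  where "generated_subalgebra S = \<Inter>{B. subalgebra B \<and> S \<subseteq> B}"

lemma cfunctionalI:
  assumes "\<And>x y. f (x + y) = f x + f y" and "\<And>c x. f (c *\<^sub>C x) = c * f x"
  shows "cfunctional f"
proof -
  interpret C: vector_space "(*) :: complex \<Rightarrow> complex \<Rightarrow> complex"
    by unfold_locales (simp_all add: algebra_simps)
  show ?thesis by unfold_locales (simp_all add: assms)
qed

lemma cfunctionalD:
  assumes "cfunctional f"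
  shows "f (x + y) = f x + f y" "f (c *\<^sub>C x) = c * f x"
proof -
  interpret Vector_Spaces.linear scaleC "(*)" f by (rule assms)
  show "f (x + y) = f x + f y" "f (c *\<^sub>C x) = c * f x" by (rule add, rule scale)
qed

lemma clinearI:
  assumes "\<And>x y. f (x + y) = f x + f y" and "\<And>c x. f (c *\<^sub>C x) = c *\<^sub>C f x"
  shows "clinear f"
  by unfold_locales (simp_all add: assms)

lemma exists_functional: "\<exists>f :: 'a::complex_algebra_1 \<Rightarrow> complex. cfunctional f \<and> f 1 = 1"
proof -
  interpret C: vector_space "(*) :: complex \<Rightarrow> complex \<Rightarrow> complex"
    by unfold_locales (simp_all add: algebra_simps)
  interpret vector_space_pair "scaleC :: complex \<Rightarrow> 'a \<Rightarrow> 'a" "(*) :: complex \<Rightarrow> complex \<Rightarrow> complex" ..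
  have "calg.independent {1::'a}" by (simp add: calg.dependent_single)
  from linear_independent_extend[OF this, of "\<lambda>_. 1"] show ?thesis by auto
qed

section \<open>The extension of an algebra by an indeterminate projection\<close>

text \<open>Generators and relations: expressions in the elements of the algebra and one
  indeterminate, modulo the least congruence containing the axioms of an algebra, the
  operations of the given algebra and \<open>1P = P1 = P\<^sup>2 = P\<close>. The zero and the unit of the
  quotient are those of the given algebra.\<close>

datatype 'a ext_term =
    Emb 'a | Ind
  | EAdd "'a ext_term" "'a ext_term"
  | EScale complex "'a ext_term"
  | EMult "'a ext_term" "'a ext_term"

inductive ext_eq :: "'a::complex_algebra_1 ext_term \<Rightarrow> 'a ext_term \<Rightarrow> bool" where
  ext_refl: "ext_eq s s"
| ext_sym: "ext_eq s t \<Longrightarrow> ext_eq t s"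
| ext_trans: "ext_eq s t \<Longrightarrow> ext_eq t u \<Longrightarrow> ext_eq s u"
| ext_cong_add: "ext_eq s s' \<Longrightarrow> ext_eq t t' \<Longrightarrow> ext_eq (EAdd s t) (EAdd s' t')"
| ext_cong_scale: "ext_eq s s' \<Longrightarrow> ext_eq (EScale c s) (EScale c s')"
| ext_cong_mult: "ext_eq s s' \<Longrightarrow> ext_eq t t' \<Longrightarrow> ext_eq (EMult s t) (EMult s' t')"
| ext_add_assoc: "ext_eq (EAdd (EAdd s t) u) (EAdd s (EAdd t u))"
| ext_add_comm: "ext_eq (EAdd s t) (EAdd t s)"
| ext_add_zero: "ext_eq (EAdd (Emb 0) s) s"
| ext_add_neg: "ext_eq (EAdd (EScale (- 1) s) s) (Emb 0)"
| ext_scale_add: "ext_eq (EScale c (EAdd s t)) (EAdd (EScale c s) (EScale c t))"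
| ext_add_scale: "ext_eq (EScale (c + d) s) (EAdd (EScale c s) (EScale d s))"
| ext_scale_scale: "ext_eq (EScale c (EScale d s)) (EScale (c * d) s)"
| ext_scale_one: "ext_eq (EScale 1 s) s"
| ext_mult_assoc: "ext_eq (EMult (EMult s t) u) (EMult s (EMult t u))"
| ext_distrib_right: "ext_eq (EMult (EAdd s t) u) (EAdd (EMult s u) (EMult t u))"
| ext_distrib_left: "ext_eq (EMult s (EAdd t u)) (EAdd (EMult s t) (EMult s u))"
| ext_mult_scale_left: "ext_eq (EMult (EScale c s) t) (EScale c (EMult s t))"
| ext_mult_scale_right: "ext_eq (EMult s (EScale c t)) (EScale c (EMult s t))"
| ext_emb_add: "ext_eq (EAdd (Emb a) (Emb b)) (Emb (a + b))"
| ext_emb_scale: "ext_eq (EScale c (Emb a)) (Emb (c *\<^sub>C a))"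
| ext_emb_mult: "ext_eq (EMult (Emb a) (Emb b)) (Emb (a * b))"
| ext_one_ind: "ext_eq (EMult (Emb 1) Ind) Ind"
| ext_ind_one: "ext_eq (EMult Ind (Emb 1)) Ind"
| ext_ind_ind: "ext_eq (EMult Ind Ind) Ind"

quotient_type (overloaded) 'a extension = "'a::complex_algebra_1 ext_term" / ext_eq
  by (intro equivpI reflpI sympI transpI) (fact ext_refl ext_sym ext_trans)+

lemma ext_eq_one_mult: "ext_eq (EMult (Emb 1) s) s"
proof (induction s)
  case (Emb a)
  show ?case using ext_emb_mult[of 1 a] by simp
next
  case Ind
  show ?case by (rule ext_one_ind)
next
  case (EAdd s t)
  then show ?case by (metis ext_distrib_left ext_cong_add ext_trans)
next
  case (EScale c s)
  then show ?case by (metis ext_mult_scale_right ext_cong_scale ext_trans)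
next
  case (EMult s t)
  then show ?case by (metis ext_mult_assoc ext_cong_mult ext_trans ext_sym ext_refl)
qed

lemma ext_eq_mult_one: "ext_eq (EMult s (Emb 1)) s"
proof (induction s)
  case (Emb a)
  show ?case using ext_emb_mult[of a 1] by simp
next
  case Ind
  show ?case by (rule ext_ind_one)
next
  case (EAdd s t)
  then show ?case by (metis ext_distrib_right ext_cong_add ext_trans)
next
  case (EScale c s)
  then show ?case by (metis ext_mult_scale_left ext_cong_scale ext_trans)
next
  case (EMult s t)
  then show ?case by (metis ext_mult_assoc ext_cong_mult ext_trans ext_refl)
qed

primrec ext_eval :: "('a \<Rightarrow> 'c::complex_algebra_1) \<Rightarrow> 'c \<Rightarrow> 'a ext_term \<Rightarrow> 'c" where
  "ext_eval h p (Emb a) = h a"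
| "ext_eval h p Ind = p"
| "ext_eval h p (EAdd s t) = ext_eval h p s + ext_eval h p t"
| "ext_eval h p (EScale c s) = c *\<^sub>C ext_eval h p s"
| "ext_eval h p (EMult s t) = ext_eval h p s * ext_eval h p t"

lemma ext_eval_cong:
  assumes "ext_eq s t" and h: "alg_hom h" "h 1 = 1" and p: "p * p = p"
  shows "ext_eval h p s = ext_eval h p t"
proof -
  interpret h: Vector_Spaces.linear scaleC scaleC h using h by (simp add: alg_hom_def)
  have m: "h (x * y) = h x * h y" for x y using h by (simp add: alg_hom_def)
  from assms(1) show ?thesis
    by induction
      (simp_all add: h.add h.scale h.zero m h p algebra_simps calg.scale_right_distrib
        calg.scale_left_distrib mult_scaleC_left mult_scaleC_right calg.scale_minus_left)
qed

instantiation extension :: (complex_algebra_1) complex_algebra_1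
begin

lift_definition zero_extension :: "'a extension" is "Emb 0" .
lift_definition one_extension :: "'a extension" is "Emb 1" .
lift_definition plus_extension :: "'a extension \<Rightarrow> 'a extension \<Rightarrow> 'a extension" is EAdd
  by (rule ext_cong_add)
lift_definition uminus_extension :: "'a extension \<Rightarrow> 'a extension" is "EScale (- 1)"
  by (rule ext_cong_scale)
lift_definition minus_extension :: "'a extension \<Rightarrow> 'a extension \<Rightarrow> 'a extension"
  is "\<lambda>s t. EAdd s (EScale (- 1) t)"
  by (intro ext_cong_add ext_cong_scale)
lift_definition times_extension :: "'a extension \<Rightarrow> 'a extension \<Rightarrow> 'a extension" is EMult
  by (rule ext_cong_mult)
lift_definition scaleC_extension :: "complex \<Rightarrow> 'a extension \<Rightarrow> 'a extension" is EScale
  by (rule ext_cong_scale)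

instance
proof
  fix a b c :: "'a extension" and x y :: complex
  show "a + b + c = a + (b + c)" by transfer (rule ext_add_assoc)
  show "a + b = b + a" by transfer (rule ext_add_comm)
  show "0 + a = a" by transfer (rule ext_add_zero)
  show "- a + a = 0" by transfer (rule ext_add_neg)
  show "a - b = a + - b" by transfer (rule ext_refl)
  show "a * b * c = a * (b * c)" by transfer (rule ext_mult_assoc)
  show "1 * a = a" by transfer (rule ext_eq_one_mult)
  show "a * 1 = a" by transfer (rule ext_eq_mult_one)
  show "(a + b) * c = a * c + b * c" by transfer (rule ext_distrib_right)
  show "a * (b + c) = a * b + a * c" by transfer (rule ext_distrib_left)
  show "x *\<^sub>C (a + b) = x *\<^sub>C a + x *\<^sub>C b" by transfer (rule ext_scale_add)
  show "(x + y) *\<^sub>C a = x *\<^sub>C a + y *\<^sub>C a" by transfer (rule ext_add_scale)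
  show "x *\<^sub>C y *\<^sub>C a = (x * y) *\<^sub>C a" by transfer (rule ext_scale_scale)
  show "1 *\<^sub>C a = a" by transfer (rule ext_scale_one)
  show "(x *\<^sub>C a) * b = x *\<^sub>C (a * b)" by transfer (rule ext_mult_scale_left)
  show "a * (x *\<^sub>C b) = x *\<^sub>C (a * b)" by transfer (rule ext_mult_scale_right)
  show "(0::'a extension) \<noteq> 1"
  proof (transfer, rule notI)
    assume "ext_eq (Emb (0::'a)) (Emb 1)"
    moreover have "alg_hom (\<lambda>x::'a. x)" by (auto simp: alg_hom_def intro!: clinearI)
    ultimately have "(0::'a) = 1" using ext_eval_cong[of "Emb 0" "Emb 1" "\<lambda>x::'a. x" 1] by simp
    then show False by simp
  qed
qed

end

lift_definition emb :: "'a::complex_algebra_1 \<Rightarrow> 'a extension" is Emb .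

lift_definition indet :: "'a::complex_algebra_1 extension" is Ind .

lemma emb_add: "emb (a + b) = emb a + emb b"
  by transfer (rule ext_sym, rule ext_emb_add)

lemma emb_mult: "emb (a * b) = emb a * emb b"
  by transfer (rule ext_sym, rule ext_emb_mult)

lemma emb_scale: "emb (c *\<^sub>C a) = c *\<^sub>C emb a"
  by transfer (rule ext_sym, rule ext_emb_scale)

lemma emb_one: "emb 1 = 1"
  by transfer (rule ext_refl)

lemma indet_idem: "indet * indet = indet"
  by transfer (rule ext_ind_ind)

lemma extension_induct [case_names emb indet add scale mult]:
  fixes x :: "'a::complex_algebra_1 extension"
  assumes "\<And>a. Q (emb a)" "Q indet" "\<And>x y. Q x \<Longrightarrow> Q y \<Longrightarrow> Q (x + y)"
    "\<And>c x. Q x \<Longrightarrow> Q (c *\<^sub>C x)" "\<And>x y. Q x \<Longrightarrow> Q y \<Longrightarrow> Q (x * y)"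
  shows "Q x"
proof -
  have "Q (abs_extension t)" for t
  proof (induction t)
    case (Emb a)
    then show ?case using assms(1)[of a] by (simp add: emb.abs_eq)
  next
    case Ind
    then show ?case using assms(2) by (simp add: indet_def)
  next
    case (EAdd s t)
    then show ?case using assms(3) by (metis plus_extension.abs_eq)
  next
    case (EScale c s)
    then show ?case using assms(4) by (metis scaleC_extension.abs_eq)
  next
    case (EMult s t)
    then show ?case using assms(5) by (metis times_extension.abs_eq)
  qed
  then show ?thesis by (cases x) (metis Quotient3_abs_rep Quotient3_extension)
qed

theorem extension_universal:
  fixes h :: "'a::complex_algebra_1 \<Rightarrow> 'c::complex_algebra_1"
  assumes h: "alg_hom h" "h 1 = 1" and p: "p * p = p"
  shows "\<exists>!g. alg_hom g \<and> g 1 = 1 \<and> (\<forall>a. g (emb a) = h a) \<and> g indet = p"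
proof (rule ex_ex1I)
  define g where "g x = ext_eval h p (rep_extension x)" for x
  have g: "g (abs_extension t) = ext_eval h p t" for t
    unfolding g_def by (rule ext_eval_cong[OF _ h p])
      (metis Quotient3_extension Quotient3_rep_abs ext_refl)
  have gt: "\<exists>t. x = abs_extension t" for x :: "'a extension"
    by (metis Quotient3_abs_rep Quotient3_extension)
  have "g (x + y) = g x + g y" "g (c *\<^sub>C x) = c *\<^sub>C g x" "g (x * y) = g x * g y" for x y c
    using gt[of x] gt[of y]
    by (auto simp: plus_extension.abs_eq scaleC_extension.abs_eq times_extension.abs_eq g)
  then have "alg_hom g" by (auto simp: alg_hom_def intro!: clinearI)
  moreover have "g 1 = 1" "g (emb a) = h a" "g indet = p" for a
    by (simp_all add: one_extension_def emb.abs_eq indet_def g h)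
  ultimately show "\<exists>g. alg_hom g \<and> g 1 = 1 \<and> (\<forall>a. g (emb a) = h a) \<and> g indet = p" by blast
next
  fix f g :: "'a extension \<Rightarrow> 'c"
  assume f: "alg_hom f \<and> f 1 = 1 \<and> (\<forall>a. f (emb a) = h a) \<and> f indet = p"
    and g: "alg_hom g \<and> g 1 = 1 \<and> (\<forall>a. g (emb a) = h a) \<and> g indet = p"
  interpret f: Vector_Spaces.linear scaleC scaleC f using f by (simp add: alg_hom_def)
  interpret g: Vector_Spaces.linear scaleC scaleC g using g by (simp add: alg_hom_def)
  have "f x = g x" for x
    by (induction x rule: extension_induct)
      (use f g in \<open>simp_all add: f.add g.add f.scale g.scale alg_hom_def\<close>)
  then show "f = g" by blast
qed

subsection \<open>The extended state\<close>

text \<open>\<open>alt_word [b\<^sub>1, ..., b\<^sub>n] = b\<^sub>1 P b\<^sub>2 P ... P b\<^sub>n\<close>; only used for nonempty lists.\<close>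

fun alt_word :: "'a::complex_algebra_1 list \<Rightarrow> 'a extension" where
  "alt_word [] = 1"
| "alt_word [b] = emb b"
| "alt_word (b # c # bs) = emb b * indet * alt_word (c # bs)"

definition extends_state ::
  "('a::complex_algebra_1 \<Rightarrow> complex) \<Rightarrow> ('a extension \<Rightarrow> complex) \<Rightarrow> bool"
  where "extends_state \<phi> \<Phi> \<longleftrightarrow> cfunctional \<Phi> \<and> \<Phi> indet = 1 \<and>
    (\<forall>\<alpha>\<in>{0,1::nat}. \<forall>\<beta>\<in>{0,1::nat}. \<forall>bs. bs \<noteq> [] \<longrightarrow>
       \<Phi> (indet ^ \<alpha> * alt_word bs * indet ^ \<beta>) = (\<Prod>b\<leftarrow>bs. \<phi> b))"

definition ext_state :: "('a::complex_algebra_1 \<Rightarrow> complex) \<Rightarrow> 'a extension \<Rightarrow> complex"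
  where "ext_state \<phi> = (THE \<Phi>. extends_state \<phi> \<Phi>)"

text \<open>Existence: the extension acts on the algebra itself, elements of the algebra by left
  multiplication and the indeterminate by \<open>x \<mapsto> \<phi>(x) 1\<close>; the extended state is
  \<open>x \<mapsto> \<phi>(x \<cdot> 1)\<close>.\<close>

primrec ext_act :: "('a \<Rightarrow> complex) \<Rightarrow> 'a ext_term \<Rightarrow> 'a \<Rightarrow> 'a::complex_algebra_1" where
  "ext_act \<phi> (Emb a) x = a * x"
| "ext_act \<phi> Ind x = \<phi> x *\<^sub>C 1"
| "ext_act \<phi> (EAdd s t) x = ext_act \<phi> s x + ext_act \<phi> t x"
| "ext_act \<phi> (EScale c s) x = c *\<^sub>C ext_act \<phi> s x"
| "ext_act \<phi> (EMult s t) x = ext_act \<phi> s (ext_act \<phi> t x)"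

lemma ext_act_linear:
  assumes "is_state \<phi>"
  shows "ext_act \<phi> t (x + y) = ext_act \<phi> t x + ext_act \<phi> t y"
    and "ext_act \<phi> t (c *\<^sub>C x) = c *\<^sub>C ext_act \<phi> t x"
proof (induction t arbitrary: x y)
  case Ind
  { case 1 show ?case using assms by (simp add: is_state_def cfunctionalD calg.scale_left_distrib) }
  { case 2 show ?case using assms by (simp add: is_state_def cfunctionalD) }
qed (simp_all add: algebra_simps mult_scaleC_right calg.scale_right_distrib)

lemma ext_act_cong:
  assumes "ext_eq s t" and "is_state \<phi>"
  shows "ext_act \<phi> s = ext_act \<phi> t"
  using assms(1)
  by induction
    (use assms(2) in \<open>simp_all add: fun_eq_iff ext_act_linear algebra_simps is_state_def cfunctionalD
      mult_scaleC_left mult_scaleC_right calg.scale_right_distrib calg.scale_left_distrib\<close>)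

lemma alt_word_Cons: "bs \<noteq> [] \<Longrightarrow> alt_word (b # bs) = emb b * indet * alt_word bs"
  by (cases bs) auto

lemma alt_word_snoc: "bs \<noteq> [] \<Longrightarrow> alt_word (bs @ [b]) = alt_word bs * indet * emb b"
  by (induction bs rule: alt_word.induct) (auto simp: alt_word_Cons mult.assoc)

lemma extends_state_exists:
  assumes "is_state \<phi>"
  shows "\<exists>\<Phi>. extends_state \<phi> \<Phi>"
proof -
  note act = ext_act_linear[OF assms]
  have \<phi>: "\<phi> (x + y) = \<phi> x + \<phi> y" "\<phi> (c *\<^sub>C x) = c * \<phi> x" "\<phi> 1 = 1" for x y c
    using assms by (simp_all add: is_state_def cfunctionalD)
  define A where "A x = ext_act \<phi> (rep_extension x)" for x
  have A: "A (abs_extension t) = ext_act \<phi> t" for t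
    unfolding A_def by (rule ext_act_cong[OF _ assms])
      (metis Quotient3_extension Quotient3_rep_abs ext_refl)
  have gt: "\<exists>t. x = abs_extension t" for x :: "'a extension"
    by (metis Quotient3_abs_rep Quotient3_extension)
  have A_simps: "A (x + y) z = A x z + A y z" "A (c *\<^sub>C x) z = c *\<^sub>C A x z"
    "A (x * y) z = A x (A y z)" for x y z c
    using gt[of x] gt[of y]
    by (auto simp: plus_extension.abs_eq scaleC_extension.abs_eq times_extension.abs_eq A)
  have A_gen: "A (emb a) z = a * z" "A indet z = \<phi> z *\<^sub>C 1" "A 1 z = z" for a z
    by (simp_all add: one_extension_def emb.abs_eq indet_def A)
  have A_lin: "A x (c *\<^sub>C z) = c *\<^sub>C A x z" for x c z
    using gt[of x] by (auto simp: A act)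
  have w: "\<phi> (A (alt_word bs) 1) = (\<Prod>b\<leftarrow>bs. \<phi> b)" for bs
    by (induction bs rule: alt_word.induct) (auto simp: A_simps A_gen A_lin \<phi> mult_scaleC_right)
  have "extends_state \<phi> (\<lambda>x. \<phi> (A x 1))"
    unfolding extends_state_def
    by (auto intro!: cfunctionalI simp: A_simps A_gen A_lin \<phi> w)
  then show ?thesis by blast
qed

lemma extends_state_unique:
  fixes \<Phi> \<Psi> :: "'a::complex_algebra_1 extension \<Rightarrow> complex"
  assumes "extends_state \<phi> \<Phi>" and "extends_state \<phi> \<Psi>"
  shows "\<Phi> = \<Psi>"
proof -
  define W where "W = insert indet
    {indet ^ \<alpha> * alt_word bs * indet ^ \<beta> | \<alpha> \<beta> (bs :: 'a list). \<alpha> \<in> {0,1::nat} \<and> \<beta> \<in> {0,1::nat} \<and> bs \<noteq> []}"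
  have W1: "indet ^ \<alpha> * alt_word bs * indet ^ \<beta> \<in> W"
    if "\<alpha> \<in> {0,1}" "\<beta> \<in> {0,1}" "bs \<noteq> []" for \<alpha> \<beta> and bs :: "'a list"
    using that unfolding W_def by blast
  have W_emb: "x * emb b \<in> W" if "x \<in> W" for x b
  proof (cases "x = indet")
    case True
    then show ?thesis using W1[of 1 0 "[b]"] by simp
  next
    case False
    then obtain \<alpha> \<beta> bs where *: "\<alpha> \<in> {0,1}" "\<beta> \<in> {0,1}" "bs \<noteq> []"
      and x: "x = indet ^ \<alpha> * alt_word bs * indet ^ \<beta>"
      using \<open>x \<in> W\<close> unfolding W_def by blast
    show ?thesis
    proof (cases "\<beta> = 0")
      case False
      then have "x * emb b = indet ^ \<alpha> * alt_word (bs @ [b]) * indet ^ 0"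
        using * by (auto simp: x alt_word_snoc mult.assoc)
      then show ?thesis using W1[of \<alpha> 0 "bs @ [b]"] * by simp
    next
      case True
      obtain cs c where bs: "bs = cs @ [c]" using * by (cases bs rule: rev_cases) auto
      have "alt_word bs * emb b = alt_word (cs @ [c * b])"
        by (cases "cs = []") (auto simp: bs alt_word_snoc emb_mult mult.assoc)
      then have "x * emb b = indet ^ \<alpha> * alt_word (cs @ [c * b]) * indet ^ 0"
        using True by (simp add: x mult.assoc)
      then show ?thesis using W1[of \<alpha> 0 "cs @ [c * b]"] * by simp
    qed
  qed
  have W_indet: "x * indet \<in> W" if "x \<in> W" for x
  proof (cases "x = indet")
    case True
    then show ?thesis by (simp add: W_def indet_idem)
  next
    case False
    then obtain \<alpha> \<beta> bs where *: "\<alpha> \<in> {0,1}" "\<beta> \<in> {0,1}" "bs \<noteq> []"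
      and x: "x = indet ^ \<alpha> * alt_word bs * indet ^ \<beta>"
      using \<open>x \<in> W\<close> unfolding W_def by blast
    then have "x * indet = indet ^ \<alpha> * alt_word bs * indet ^ 1"
      by (auto simp: mult.assoc indet_idem)
    then show ?thesis using W1[of \<alpha> 1 bs] * by simp
  qed
  have span_mult: "x * y \<in> calg.span W" if "\<And>x. x \<in> W \<Longrightarrow> x * y \<in> calg.span W" "x \<in> calg.span W" for x y
    using that(2)
  proof (induction rule: calg.span_induct_alt)
    case base
    then show ?case by (simp add: calg.span_zero)
  next
    case (step c x z)
    then show ?case
      by (simp add: distrib_right mult_scaleC_left calg.span_add calg.span_scale that(1))
  qed
  have "\<forall>x \<in> calg.span W. x * y \<in> calg.span W" for y
  proof (induction y rule: extension_induct)
    case (emb a)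
    show ?case using span_mult W_emb calg.span_base by blast
  next
    case indet
    show ?case using span_mult W_indet calg.span_base by blast
  next
    case (add x y)
    then show ?case by (simp add: distrib_left calg.span_add)
  next
    case (scale c x)
    then show ?case by (simp add: mult_scaleC_right calg.span_scale)
  next
    case (mult x y)
    then show ?case by (simp flip: mult.assoc)
  qed
  moreover have "1 \<in> calg.span W"
    using calg.span_base[OF W1[of 0 0 "[1]"]] by (simp add: emb_one)
  ultimately have span: "y \<in> calg.span W" for y by (metis mult_1)
  have W_eq: "\<Phi> x = \<Psi> x" if "x \<in> W" for x
    using that assms unfolding W_def extends_state_def by auto
  have lin: "\<Phi> (x + y) = \<Phi> x + \<Phi> y" "\<Phi> (c *\<^sub>C x) = c * \<Phi> x"
    "\<Psi> (x + y) = \<Psi> x + \<Psi> y" "\<Psi> (c *\<^sub>C x) = c * \<Psi> x" for x y c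
    using assms unfolding extends_state_def by (simp_all add: cfunctionalD)
  have "\<Phi> y = \<Psi> y" for y
    using span[of y]
  proof (induction rule: calg.span_induct_alt)
    case base
    show ?case using lin(2,4)[of 0 0] by simp
  next
    case (step c x z)
    then show ?case by (simp add: lin W_eq)
  qed
  then show ?thesis by blast
qed

theorem ext_state_extends:
  assumes "is_state \<phi>"
  shows "extends_state \<phi> (ext_state \<phi>)"
  unfolding ext_state_def
  using extends_state_exists[OF assms] extends_state_unique by (metis theI)

lemma is_state_ext_state:
  assumes "is_state \<phi>"
  shows "is_state (ext_state \<phi>)"
proof -
  have *: "extends_state \<phi> (ext_state \<phi>)" using assms by (rule ext_state_extends)
  then have "\<forall>bs. bs \<noteq> [] \<longrightarrow>
      ext_state \<phi> (indet ^ 0 * alt_word bs * indet ^ 0) = (\<Prod>b\<leftarrow>bs. \<phi> b)"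
    unfolding extends_state_def by blast
  from this[rule_format, of "[1]"] * assms show ?thesis
    by (simp add: emb_one is_state_def extends_state_def)
qed

section \<open>Tensor products of algebras and product states\<close>

text \<open>The tensor product as vector space: formal linear combinations of symbols \<open>a \<otimes> b\<close>
  modulo the least congruence containing the vector space axioms and bilinearity, with
  \<open>0 \<otimes> 0\<close> as zero.\<close>

datatype ('a, 'b) tensor_term =
    Pure 'a 'b
  | TAdd "('a, 'b) tensor_term" "('a, 'b) tensor_term"
  | TScale complex "('a, 'b) tensor_term"

inductive tensor_eq ::
  "('a::complex_algebra_1, 'b::complex_algebra_1) tensor_term \<Rightarrow> ('a, 'b) tensor_term \<Rightarrow> bool" where
  ten_refl: "tensor_eq s s"
| ten_sym: "tensor_eq s t \<Longrightarrow> tensor_eq t s"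
| ten_trans: "tensor_eq s t \<Longrightarrow> tensor_eq t u \<Longrightarrow> tensor_eq s u"
| ten_cong_add: "tensor_eq s s' \<Longrightarrow> tensor_eq t t' \<Longrightarrow> tensor_eq (TAdd s t) (TAdd s' t')"
| ten_cong_scale: "tensor_eq s s' \<Longrightarrow> tensor_eq (TScale c s) (TScale c s')"
| ten_add_assoc: "tensor_eq (TAdd (TAdd s t) u) (TAdd s (TAdd t u))"
| ten_add_comm: "tensor_eq (TAdd s t) (TAdd t s)"
| ten_add_zero: "tensor_eq (TAdd (Pure 0 0) s) s"
| ten_add_neg: "tensor_eq (TAdd (TScale (- 1) s) s) (Pure 0 0)"
| ten_scale_add: "tensor_eq (TScale c (TAdd s t)) (TAdd (TScale c s) (TScale c t))"
| ten_add_scale: "tensor_eq (TScale (c + d) s) (TAdd (TScale c s) (TScale d s))"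
| ten_scale_scale: "tensor_eq (TScale c (TScale d s)) (TScale (c * d) s)"
| ten_scale_one: "tensor_eq (TScale 1 s) s"
| ten_pure_add_left: "tensor_eq (Pure (a + a') b) (TAdd (Pure a b) (Pure a' b))"
| ten_pure_add_right: "tensor_eq (Pure a (b + b')) (TAdd (Pure a b) (Pure a b'))"
| ten_pure_scale_left: "tensor_eq (Pure (c *\<^sub>C a) b) (TScale c (Pure a b))"
| ten_pure_scale_right: "tensor_eq (Pure a (c *\<^sub>C b)) (TScale c (Pure a b))"

quotient_type (overloaded) ('a, 'b) tensor =
  "('a::complex_algebra_1, 'b::complex_algebra_1) tensor_term" / tensor_eq
  by (intro equivpI reflpI sympI transpI) (fact tensor_eq.ten_refl tensor_eq.ten_sym ten_trans)+

text \<open>Multiplication extends \<open>(a \<otimes> b)(c \<otimes> d) = ac \<otimes> bd\<close> bilinearly.\<close>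

primrec pure_mult :: "'a::complex_algebra_1 \<Rightarrow> 'b::complex_algebra_1 \<Rightarrow>
    ('a, 'b) tensor_term \<Rightarrow> ('a, 'b) tensor_term" where
  "pure_mult a b (Pure c d) = Pure (a * c) (b * d)"
| "pure_mult a b (TAdd s t) = TAdd (pure_mult a b s) (pure_mult a b t)"
| "pure_mult a b (TScale x s) = TScale x (pure_mult a b s)"

primrec term_mult :: "('a::complex_algebra_1, 'b::complex_algebra_1) tensor_term \<Rightarrow>
    ('a, 'b) tensor_term \<Rightarrow> ('a, 'b) tensor_term" where
  "term_mult (Pure a b) u = pure_mult a b u"
| "term_mult (TAdd s t) u = TAdd (term_mult s u) (term_mult t u)"
| "term_mult (TScale x s) u = TScale x (term_mult s u)"

text \<open>Evaluation along a map of two variables, for functionals on the tensor product.\<close>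

primrec tensor_eval :: "('a \<Rightarrow> 'b \<Rightarrow> complex) \<Rightarrow> ('a, 'b) tensor_term \<Rightarrow> complex" where
  "tensor_eval f (Pure a b) = f a b"
| "tensor_eval f (TAdd s t) = tensor_eval f s + tensor_eval f t"
| "tensor_eval f (TScale c s) = c * tensor_eval f s"

lemma tensor_eval_cong:
  assumes "tensor_eq s t" and "\<And>b. cfunctional (\<lambda>a. f a b)" and "\<And>a. cfunctional (f a)"
  shows "tensor_eval f s = tensor_eval f t"
proof -
  note f = cfunctionalD[OF assms(2)] cfunctionalD[OF assms(3)]
  have f0: "f 0 b = 0" for b using f(2)[of 0 0 b] by simp
  from assms(1) show ?thesis by induction (simp_all add: f f0 algebra_simps)
qed

declare tensor_eq.ten_trans [trans]

lemma tensor_swap: "tensor_eq (TAdd (TAdd a b) (TAdd c d)) (TAdd (TAdd a c) (TAdd b d))"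
proof -
  have "tensor_eq (TAdd b (TAdd c d)) (TAdd (TAdd b c) d)"
    by (rule tensor_eq.ten_sym, rule tensor_eq.ten_add_assoc)
  also have "tensor_eq \<dots> (TAdd (TAdd c b) d)"
    by (rule tensor_eq.ten_cong_add[OF tensor_eq.ten_add_comm tensor_eq.ten_refl])
  also have "tensor_eq \<dots> (TAdd c (TAdd b d))"
    by (rule tensor_eq.ten_add_assoc)
  finally have *: "tensor_eq (TAdd b (TAdd c d)) (TAdd c (TAdd b d))" .
  have "tensor_eq (TAdd (TAdd a b) (TAdd c d)) (TAdd a (TAdd b (TAdd c d)))"
    by (rule tensor_eq.ten_add_assoc)
  also have "tensor_eq \<dots> (TAdd a (TAdd c (TAdd b d)))"
    by (rule tensor_eq.ten_cong_add[OF tensor_eq.ten_refl *])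
  also have "tensor_eq \<dots> (TAdd (TAdd a c) (TAdd b d))"
    by (rule tensor_eq.ten_sym, rule tensor_eq.ten_add_assoc)
  finally show ?thesis .
qed

lemma tensor_scale_comm: "tensor_eq (TScale c (TScale d s)) (TScale d (TScale c s))"
  by (metis tensor_eq.ten_scale_scale tensor_eq.ten_sym tensor_eq.ten_trans mult.commute)

lemma pure_mult_cong: "tensor_eq s t \<Longrightarrow> tensor_eq (pure_mult a b s) (pure_mult a b t)"
proof (induction rule: tensor_eq.induct)
  case (ten_sym s t) then show ?case by (simp add: tensor_eq.ten_sym)
next
  case (ten_trans s t u) then show ?case by (metis tensor_eq.ten_trans)
qed (simp_all add: tensor_eq.intros(1,4-) distrib_left mult_scaleC_right)

lemma pure_mult_add_left:
  "tensor_eq (pure_mult (a + a') b s) (TAdd (pure_mult a b s) (pure_mult a' b s))"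
proof (induction s)
  case (Pure c d) then show ?case by (simp add: distrib_right tensor_eq.ten_pure_add_left)
next
  case (TAdd s t)
  then show ?case by simp (meson tensor_swap tensor_eq.ten_cong_add ten_trans)
next
  case (TScale x s)
  then show ?case by simp (meson tensor_eq.ten_cong_scale tensor_eq.ten_scale_add ten_trans)
qed

lemma pure_mult_add_right:
  "tensor_eq (pure_mult a (b + b') s) (TAdd (pure_mult a b s) (pure_mult a b' s))"
proof (induction s)
  case (Pure c d) then show ?case by (simp add: distrib_right tensor_eq.ten_pure_add_right)
next
  case (TAdd s t)
  then show ?case by simp (meson tensor_swap tensor_eq.ten_cong_add ten_trans)
next
  case (TScale x s)
  then show ?case by simp (meson tensor_eq.ten_cong_scale tensor_eq.ten_scale_add ten_trans)
qed

lemma pure_mult_scale_left: "tensor_eq (pure_mult (c *\<^sub>C a) b s) (TScale c (pure_mult a b s))"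
proof (induction s)
  case (Pure c d) then show ?case by (simp add: mult_scaleC_left tensor_eq.ten_pure_scale_left)
next
  case (TAdd s t)
  then show ?case by simp (meson tensor_eq.ten_cong_add tensor_eq.ten_scale_add tensor_eq.ten_trans tensor_eq.ten_sym)
next
  case (TScale x s)
  then show ?case by simp (meson tensor_eq.ten_cong_scale tensor_scale_comm ten_trans)
qed

lemma pure_mult_scale_right: "tensor_eq (pure_mult a (c *\<^sub>C b) s) (TScale c (pure_mult a b s))"
proof (induction s)
  case (Pure c d) then show ?case by (simp add: mult_scaleC_left tensor_eq.ten_pure_scale_right)
next
  case (TAdd s t)
  then show ?case by simp (meson tensor_eq.ten_cong_add tensor_eq.ten_scale_add tensor_eq.ten_trans tensor_eq.ten_sym)
next
  case (TScale x s)
  then show ?case by simp (meson tensor_eq.ten_cong_scale tensor_scale_comm ten_trans)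
qed

lemma pure_mult_zero: "tensor_eq (pure_mult 0 0 s) (Pure 0 0)"
proof (induction s)
  case (Pure c d) then show ?case by (simp add: tensor_eq.ten_refl)
next
  case (TAdd s t)
  then show ?case by simp (meson tensor_eq.ten_cong_add tensor_eq.ten_add_zero ten_trans)
next
  case (TScale x s)
  have "tensor_eq (TScale x (Pure 0 0)) (Pure (x *\<^sub>C 0) 0 :: ('a, 'b) tensor_term)"
    by (rule tensor_eq.ten_sym, rule tensor_eq.ten_pure_scale_left)
  with TScale show ?case by simp (meson tensor_eq.ten_cong_scale ten_trans)
qed

lemma term_mult_cong_right: "tensor_eq t u \<Longrightarrow> tensor_eq (term_mult s t) (term_mult s u)"
  by (induction s) (simp_all add: pure_mult_cong tensor_eq.ten_cong_add tensor_eq.ten_cong_scale)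

lemma term_mult_cong_left: "tensor_eq s t \<Longrightarrow> tensor_eq (term_mult s u) (term_mult t u)"
proof (induction rule: tensor_eq.induct)
  case (ten_sym s t) then show ?case by (simp add: tensor_eq.ten_sym)
next
  case (ten_trans s t u) then show ?case by (metis tensor_eq.ten_trans)
next
  case (ten_add_zero s)
  have "tensor_eq (TAdd (pure_mult 0 0 u) (term_mult s u)) (TAdd (Pure 0 0) (term_mult s u))"
    by (rule tensor_eq.ten_cong_add[OF pure_mult_zero tensor_eq.ten_refl])
  from tensor_eq.ten_trans[OF this tensor_eq.ten_add_zero[of "term_mult s u"]] show ?case by simp
next
  case (ten_add_neg s)
  from tensor_eq.ten_trans[OF tensor_eq.ten_add_neg[of "term_mult s u"] tensor_eq.ten_sym[OF pure_mult_zero]] show ?case by simp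
qed (simp_all add: tensor_eq.intros(1,4-13) pure_mult_add_left pure_mult_add_right
      pure_mult_scale_left pure_mult_scale_right)

lemma term_mult_cong:
  "tensor_eq s s' \<Longrightarrow> tensor_eq t t' \<Longrightarrow> tensor_eq (term_mult s t) (term_mult s' t')"
  by (meson term_mult_cong_left term_mult_cong_right ten_trans)

lemma pure_mult_assoc: "pure_mult a b (pure_mult c d u) = pure_mult (a * c) (b * d) u"
  by (induction u) (simp_all add: mult.assoc)

lemma pure_mult_term_mult: "pure_mult a b (term_mult t u) = term_mult (pure_mult a b t) u"
  by (induction t) (simp_all add: pure_mult_assoc)

lemma term_mult_assoc: "term_mult (term_mult s t) u = term_mult s (term_mult t u)"
  by (induction s) (simp_all add: pure_mult_term_mult)

lemma term_mult_add_right: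
  "tensor_eq (term_mult s (TAdd t u)) (TAdd (term_mult s t) (term_mult s u))"
proof (induction s)
  case (Pure c d) then show ?case by (simp add: tensor_eq.ten_refl)
next
  case (TAdd s s')
  then show ?case by simp (meson tensor_swap tensor_eq.ten_cong_add ten_trans)
next
  case (TScale x s)
  then show ?case by simp (meson tensor_eq.ten_cong_scale tensor_eq.ten_scale_add ten_trans)
qed

lemma term_mult_scale_right: "tensor_eq (term_mult s (TScale c t)) (TScale c (term_mult s t))"
proof (induction s)
  case (Pure c d) then show ?case by (simp add: tensor_eq.ten_refl)
next
  case (TAdd s s')
  then show ?case by simp (meson tensor_eq.ten_cong_add tensor_eq.ten_scale_add tensor_eq.ten_trans tensor_eq.ten_sym)
next
  case (TScale x s)
  then show ?case by simp (meson tensor_eq.ten_cong_scale tensor_scale_comm ten_trans)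
qed

lemma term_mult_one: "term_mult (Pure 1 1) s = s" "term_mult s (Pure 1 1) = s"
  by (induction s) simp_all

instantiation tensor :: (complex_algebra_1, complex_algebra_1) complex_algebra_1
begin

lift_definition zero_tensor :: "('a, 'b) tensor" is "Pure 0 0" .
lift_definition one_tensor :: "('a, 'b) tensor" is "Pure 1 1" .
lift_definition plus_tensor :: "('a, 'b) tensor \<Rightarrow> ('a, 'b) tensor \<Rightarrow> ('a, 'b) tensor" is TAdd
  by (rule tensor_eq.ten_cong_add)
lift_definition uminus_tensor :: "('a, 'b) tensor \<Rightarrow> ('a, 'b) tensor" is "TScale (- 1)"
  by (rule tensor_eq.ten_cong_scale)
lift_definition minus_tensor :: "('a, 'b) tensor \<Rightarrow> ('a, 'b) tensor \<Rightarrow> ('a, 'b) tensor"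
  is "\<lambda>s t. TAdd s (TScale (- 1) t)"
  by (intro tensor_eq.ten_cong_add tensor_eq.ten_cong_scale)
lift_definition times_tensor :: "('a, 'b) tensor \<Rightarrow> ('a, 'b) tensor \<Rightarrow> ('a, 'b) tensor" is term_mult
  by (rule term_mult_cong)
lift_definition scaleC_tensor :: "complex \<Rightarrow> ('a, 'b) tensor \<Rightarrow> ('a, 'b) tensor" is TScale
  by (rule tensor_eq.ten_cong_scale)

instance
proof
  fix a b c :: "('a, 'b) tensor" and x y :: complex
  show "a + b + c = a + (b + c)" by transfer (rule tensor_eq.ten_add_assoc)
  show "a + b = b + a" by transfer (rule tensor_eq.ten_add_comm)
  show "0 + a = a" by transfer (rule tensor_eq.ten_add_zero)
  show "- a + a = 0" by transfer (rule tensor_eq.ten_add_neg)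
  show "a - b = a + - b" by transfer (rule tensor_eq.ten_refl)
  show "a * b * c = a * (b * c)" by transfer (simp add: term_mult_assoc tensor_eq.ten_refl)
  show "1 * a = a" by transfer (simp add: term_mult_one tensor_eq.ten_refl del: term_mult.simps)
  show "a * 1 = a" by transfer (simp add: term_mult_one tensor_eq.ten_refl)
  show "(a + b) * c = a * c + b * c" by transfer (simp add: tensor_eq.ten_refl)
  show "a * (b + c) = a * b + a * c" by transfer (rule term_mult_add_right)
  show "x *\<^sub>C (a + b) = x *\<^sub>C a + x *\<^sub>C b" by transfer (rule tensor_eq.ten_scale_add)
  show "(x + y) *\<^sub>C a = x *\<^sub>C a + y *\<^sub>C a" by transfer (rule tensor_eq.ten_add_scale)
  show "x *\<^sub>C y *\<^sub>C a = (x * y) *\<^sub>C a" by transfer (rule tensor_eq.ten_scale_scale)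
  show "1 *\<^sub>C a = a" by transfer (rule tensor_eq.ten_scale_one)
  show "(x *\<^sub>C a) * b = x *\<^sub>C (a * b)" by transfer (simp add: tensor_eq.ten_refl)
  show "a * (x *\<^sub>C b) = x *\<^sub>C (a * b)" by transfer (rule term_mult_scale_right)
  show "(0::('a, 'b) tensor) \<noteq> 1"
  proof (transfer, rule notI)
    assume *: "tensor_eq (Pure (0::'a) (0::'b)) (Pure 1 1)"
    obtain f :: "'a \<Rightarrow> complex" where f: "cfunctional f" "f 1 = 1"
      using exists_functional by blast
    obtain g :: "'b \<Rightarrow> complex" where g: "cfunctional g" "g 1 = 1"
      using exists_functional by blast
    have "tensor_eval (\<lambda>a b. f a * g b) (Pure 0 0) = tensor_eval (\<lambda>a b. f a * g b) (Pure 1 1)"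
      by (rule tensor_eval_cong[OF *])
        (auto intro!: cfunctionalI simp: cfunctionalD[OF f(1)] cfunctionalD[OF g(1)] algebra_simps)
    then show False
      using f(2) g(2) cfunctionalD(2)[OF f(1), of 0 0] by simp
  qed
qed

end

lift_definition tensor_pure :: "'a::complex_algebra_1 \<Rightarrow> 'b::complex_algebra_1 \<Rightarrow> ('a, 'b) tensor"
  (infixl "\<otimes>" 72) is Pure .

lemma tensor_add_left: "(a + a') \<otimes> b = a \<otimes> b + a' \<otimes> b"
  by transfer (rule tensor_eq.ten_pure_add_left)

lemma tensor_add_right: "a \<otimes> (b + b') = a \<otimes> b + a \<otimes> b'"
  by transfer (rule tensor_eq.ten_pure_add_right)

lemma tensor_scale_left: "(c *\<^sub>C a) \<otimes> b = c *\<^sub>C (a \<otimes> b)"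
  by transfer (rule tensor_eq.ten_pure_scale_left)

lemma tensor_scale_right: "a \<otimes> (c *\<^sub>C b) = c *\<^sub>C (a \<otimes> b)"
  by transfer (rule tensor_eq.ten_pure_scale_right)

lemma tensor_mult: "(a \<otimes> b) * (c \<otimes> d) = (a * c) \<otimes> (b * d)"
  by transfer (simp add: tensor_eq.ten_refl)

lemma tensor_one: "1 \<otimes> 1 = 1"
  by transfer (rule tensor_eq.ten_refl)

lemma tensor_induct [case_names pure add scale]:
  fixes x :: "('a::complex_algebra_1, 'b::complex_algebra_1) tensor"
  assumes "\<And>a b. Q (a \<otimes> b)" "\<And>x y. Q x \<Longrightarrow> Q y \<Longrightarrow> Q (x + y)" "\<And>c x. Q x \<Longrightarrow> Q (c *\<^sub>C x)"
  shows "Q x"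
proof -
  have "Q (abs_tensor t)" for t
  proof (induction t)
    case (Pure a b)
    then show ?case using assms(1)[of a b] by (simp add: tensor_pure.abs_eq)
  next
    case (TAdd s t)
    then show ?case using assms(2) by (metis plus_tensor.abs_eq)
  next
    case (TScale c s)
    then show ?case using assms(3) by (metis scaleC_tensor.abs_eq)
  qed
  then show ?thesis by (metis Quotient3_abs_rep Quotient3_tensor)
qed

theorem tensor_universal:
  fixes f :: "'a::complex_algebra_1 \<Rightarrow> 'b::complex_algebra_1 \<Rightarrow> complex"
  assumes "\<And>b. cfunctional (\<lambda>a. f a b)" and "\<And>a. cfunctional (f a)"
  shows "\<exists>!h. cfunctional h \<and> (\<forall>a b. h (a \<otimes> b) = f a b)"
proof (rule ex_ex1I)
  define h where "h x = tensor_eval f (rep_tensor x)" for x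
  have h: "h (abs_tensor t) = tensor_eval f t" for t
    unfolding h_def by (rule tensor_eval_cong[OF _ assms])
      (metis Quotient3_tensor Quotient3_rep_abs tensor_eq.ten_refl)
  have ht: "\<exists>t. x = abs_tensor t" for x :: "('a, 'b) tensor"
    by (metis Quotient3_abs_rep Quotient3_tensor)
  have "h (x + y) = h x + h y" "h (c *\<^sub>C x) = c * h x" for x y c
    using ht[of x] ht[of y] by (auto simp: plus_tensor.abs_eq scaleC_tensor.abs_eq h)
  then have "cfunctional h" by (rule cfunctionalI)
  moreover have "h (a \<otimes> b) = f a b" for a b by (simp add: tensor_pure.abs_eq h)
  ultimately show "\<exists>h. cfunctional h \<and> (\<forall>a b. h (a \<otimes> b) = f a b)" by blast
next
  fix g h :: "('a, 'b) tensor \<Rightarrow> complex"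
  assume g: "cfunctional g \<and> (\<forall>a b. g (a \<otimes> b) = f a b)"
    and h: "cfunctional h \<and> (\<forall>a b. h (a \<otimes> b) = f a b)"
  have "g x = h x" for x
    by (induction x rule: tensor_induct) (use g h in \<open>simp_all add: cfunctionalD\<close>)
  then show "g = h" by blast
qed

definition tensor_functional :: "('a::complex_algebra_1 \<Rightarrow> complex) \<Rightarrow>
    ('b::complex_algebra_1 \<Rightarrow> complex) \<Rightarrow> ('a, 'b) tensor \<Rightarrow> complex"  (infixl "\<otimes>\<^sub>f" 72)
  where "f \<otimes>\<^sub>f g = (THE h. cfunctional h \<and> (\<forall>a b. h (a \<otimes> b) = f a * g b))"

lemma tensor_functional:
  assumes "cfunctional f" and "cfunctional g"
  shows "cfunctional (f \<otimes>\<^sub>f g)" and "(f \<otimes>\<^sub>f g) (a \<otimes> b) = f a * g b"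
proof -
  have "\<exists>!h. cfunctional h \<and> (\<forall>a b. h (a \<otimes> b) = f a * g b)"
    by (rule tensor_universal)
      (auto intro!: cfunctionalI simp: cfunctionalD[OF assms(1)] cfunctionalD[OF assms(2)] algebra_simps)
  from theI'[OF this] show "cfunctional (f \<otimes>\<^sub>f g)" "(f \<otimes>\<^sub>f g) (a \<otimes> b) = f a * g b"
    unfolding tensor_functional_def by blast+
qed

lemma is_state_tensor_functional:
  assumes "is_state f" and "is_state g"
  shows "is_state (f \<otimes>\<^sub>f g)"
  using assms tensor_functional[of f g] by (simp add: is_state_def flip: tensor_one)

section \<open>Monotone and c-monotone independence\<close>

text \<open>Empty products need no separate convention: \<^term>\<open>prod_list []\<close> is the unit, where
  states take the value 1. The identity for \<open>\<phi>\<close> in \<open>c_monotone_independent\<close>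
  requires only the peak condition at the chosen position, not that neighbouring indices
  differ elsewhere.

  A word \<open>b\<^sub>1 \<cdots> b\<^sub>n\<close> with \<open>b\<^sub>k \<in> B\<^bsub>j\<^sub>k\<^esub>\<close> is a pair of lists; positions count from 0.\<close>

definition peak :: "'j::linorder list \<Rightarrow> nat \<Rightarrow> bool"
  where "peak js i \<longleftrightarrow> i < length js \<and>
    (0 < i \<longrightarrow> js ! (i - 1) < js ! i) \<and>
    (i + 1 < length js \<longrightarrow> js ! (i + 1) < js ! i)"

definition monotone_independent ::
  "'j::linorder set \<Rightarrow> ('j \<Rightarrow> 'a::complex_algebra_1 set) \<Rightarrow> ('a \<Rightarrow> complex) \<Rightarrow> bool"
  where "monotone_independent J B \<psi> \<longleftrightarrow>
    (\<forall>j\<in>J. subalgebra (B j)) \<and>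
    (\<forall>js bs i. set js \<subseteq> J \<longrightarrow> list_all2 (\<lambda>j b. b \<in> B j) js bs \<longrightarrow> distinct_adj js \<longrightarrow> peak js i \<longrightarrow>
      \<psi> (prod_list bs) = \<psi> (bs ! i) * \<psi> (prod_list (take i bs @ drop (i + 1) bs)))"

definition c_monotone_independent ::
  "'j::linorder set \<Rightarrow> ('j \<Rightarrow> 'a::complex_algebra_1 set) \<Rightarrow>
    ('a \<Rightarrow> complex) \<Rightarrow> ('a \<Rightarrow> complex) \<Rightarrow> bool"
  where "c_monotone_independent J B \<phi> \<psi> \<longleftrightarrow>
    monotone_independent J B \<psi> \<and>
    (\<forall>js bs i. set js \<subseteq> J \<longrightarrow> list_all2 (\<lambda>j b. b \<in> B j) js bs \<longrightarrow> peak js i \<longrightarrow>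
      \<phi> (prod_list bs) =
        (\<phi> (bs ! i) - \<psi> (bs ! i)) * \<phi> (prod_list (take i bs)) * \<phi> (prod_list (drop (i + 1) bs))
        + \<psi> (bs ! i) * \<phi> (prod_list (take i bs @ drop (i + 1) bs)))"

section \<open>The embeddings are homomorphisms\<close>

lemma alg_hom_first:
  "alg_hom (\<lambda>a::'a::complex_algebra_1. emb a \<otimes> (indet :: 'b::complex_algebra_1 extension) \<otimes> (indet :: 'b extension))"
  unfolding alg_hom_def
  by (auto intro!: clinearI simp: emb_add emb_scale emb_mult tensor_add_left tensor_scale_left
      tensor_mult indet_idem)

lemma tensor_zero_left: "0 \<otimes> b = 0"
  using tensor_scale_left[of 0 0 b] by simp

lemma alg_hom_second:
  "alg_hom (\<lambda>a::'b::complex_algebra_1. (indet :: 'a::complex_algebra_1 extension) \<otimes> emb a \<otimes> 1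
      + (1 - indet) \<otimes> 1 \<otimes> emb a)"
proof -
  have P: "indet * (1 - indet) = 0" "(1 - indet) * indet = 0"
    "(1 - indet) * (1 - indet) = 1 - (indet :: 'a extension)"
    by (simp_all add: left_diff_distrib right_diff_distrib indet_idem)
  show ?thesis
    unfolding alg_hom_def
    by (intro conjI allI clinearI)
      (simp_all add: emb_add emb_scale emb_mult tensor_add_left tensor_add_right tensor_scale_left
        tensor_scale_right tensor_mult P indet_idem tensor_zero_left scaleC_add_right
        distrib_left distrib_right)
qed

end

theory Submission
  imports Defs
begin

text \<open>The extended state \<open>\<Phi>\<close> of \<open>\<phi>\<close> splits at the indeterminate, \<open>\<Phi>(x P y) = \<Phi>(x) \<Phi>(y)\<close>: the
  indeterminate acts like the rank-one projection onto a cyclic vector implementing \<open>\<phi>\<close>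
  (\<open>splits_at_ext_state\<close>). Splitting passes to product functionals, so the product
  \<open>F = \<Phi>\<^sub>1 \<otimes> \<Phi>\<^sub>2 \<otimes> \<Phi>\<^sub>3\<close> of the extensions of states \<open>\<phi>\<^sub>1, \<phi>\<^sub>2, \<phi>\<^sub>3\<close> splits at \<open>\<omega> = P \<otimes> Q \<otimes> Q\<close>, and
  sandwiching an argument of \<open>F\<close> between two copies of \<open>\<omega>\<close> does not change the value.

  Put \<open>E = 1 \<otimes> Q \<otimes> Q\<close>. Elements \<open>a \<otimes> Q \<otimes> Q\<close> of the first algebra absorb \<open>E\<close> on both sides, and
  so does \<open>\<omega>\<close>. A factor \<open>j\<^sub>2(b)\<close> at a peak has on each side either an element of the first
  algebra or the end of the word, where \<open>\<omega>\<close> may be inserted; hence it may be replaced by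
  \<open>E j\<^sub>2(b) E = P \<otimes> QbQ \<otimes> Q + (1 - P) \<otimes> Q \<otimes> QbQ\<close>. Under \<open>F\<close> the block \<open>QbQ\<close> behaves like
  \<open>\<phi>\<^sub>2(b) Q\<close> in the second leg and like \<open>\<phi>\<^sub>3(b) Q\<close> in the third. The factor therefore acts as
  \<open>\<phi>\<^sub>2(b) \<omega> + \<phi>\<^sub>3(b) (E - \<omega>) = (\<phi>\<^sub>2(b) - \<phi>\<^sub>3(b)) \<omega> + \<phi>\<^sub>3(b) E\<close>.
  At \<open>\<omega>\<close> the word is cut into two independent parts, whereas \<open>E\<close> is absorbed and just deletes the
  factor. This is the c-monotone formula (\<open>product_state_peak\<close>). It gives the identity for \<open>\<phi>\<close>
  with \<open>\<phi>\<^sub>3 = \<psi>\<^sub>2\<close>; for \<open>\<psi>\<close> the second and third leg carry the same state, the cutting term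
  vanishes, and monotone independence remains. The word consisting of the peak alone gives the
  marginals on the second algebra.\<close>

section \<open>Functionals that split at an element\<close>

definition splits_at :: "('a::complex_algebra_1 \<Rightarrow> complex) \<Rightarrow> 'a \<Rightarrow> bool"
  where "splits_at F p \<longleftrightarrow> (\<forall>x y. F (x * p * y) = F x * F y)"

lemma splits_atD: "splits_at F p \<Longrightarrow> F (x * p * y) = F x * F y"
  by (simp add: splits_at_def)

lemma splits_at_absorb:
  assumes "splits_at F p" and "F 1 = 1"
  shows "F (p * x) = F x" and "F (x * p) = F x"
  using splits_atD[OF assms(1), of 1 x] splits_atD[OF assms(1), of x 1] assms(2) by simp_all

lemma splits_at_sandwich:
  assumes "splits_at F p"
  shows "F (x * (p * b * p) * y) = F b * F (x * p * y)"
proof -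
  have "F (x * (p * b * p) * y) = F (x * p * (b * p * y))"
    by (simp add: mult.assoc)
  then show ?thesis by (simp add: splits_atD[OF assms])
qed

section \<open>The extended state splits at the indeterminate\<close>

lemma cfunctional_ext_state: "is_state \<phi> \<Longrightarrow> cfunctional (ext_state \<phi>)"
  using is_state_ext_state by (auto simp: is_state_def)

lemma ext_state_indet: "is_state \<phi> \<Longrightarrow> ext_state \<phi> indet = 1"
  using ext_state_extends by (auto simp: extends_state_def)

lemma ext_state_emb:
  assumes "is_state \<phi>"
  shows "ext_state \<phi> (emb a) = \<phi> a"
proof -
  have "\<forall>bs. bs \<noteq> [] \<longrightarrow>
      ext_state \<phi> (indet ^ 0 * alt_word bs * indet ^ 0) = (\<Prod>b\<leftarrow>bs. \<phi> b)"
    using ext_state_extends[OF assms] unfolding extends_state_def by blast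
  from this[rule_format, of "[a]"] show ?thesis by simp
qed

text \<open>The words in the algebra and the indeterminate span the extension. With \<open>\<Phi>\<close> the extension
  of any state whatsoever, \<open>\<Phi> + D\<close> extends the same state, so uniqueness of the extension
  already contains this spanning property.\<close>

lemma functional_zero_if_zero_on_words:
  fixes D :: "'a::complex_algebra_1 extension \<Rightarrow> complex"
  assumes D: "cfunctional D" and "D indet = 0"
    and "\<And>\<alpha> \<beta> bs. \<alpha> \<in> {0,1::nat} \<Longrightarrow> \<beta> \<in> {0,1::nat} \<Longrightarrow> bs \<noteq> [] \<Longrightarrow>
      D (indet ^ \<alpha> * alt_word bs * indet ^ \<beta>) = 0"
  shows "D x = 0"
proof -
  obtain \<phi> :: "'a \<Rightarrow> complex" where "is_state \<phi>"
    using exists_functional unfolding is_state_def by blast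
  then have ext: "extends_state \<phi> (ext_state \<phi>)" by (rule ext_state_extends)
  then have lin: "cfunctional (ext_state \<phi>)" by (simp add: extends_state_def)
  have "cfunctional (\<lambda>x. ext_state \<phi> x + D x)"
    by (rule cfunctionalI) (simp_all add: cfunctionalD[OF lin] cfunctionalD[OF D] algebra_simps)
  with ext assms have "extends_state \<phi> (\<lambda>x. ext_state \<phi> x + D x)"
    unfolding extends_state_def by simp
  from extends_state_unique[OF this ext] show ?thesis by (simp add: fun_eq_iff)
qed

lemma functional_eq_if_eq_on_words:
  fixes F G :: "'a::complex_algebra_1 extension \<Rightarrow> complex"
  assumes F: "cfunctional F" and G: "cfunctional G" and "F indet = G indet"
    and "\<And>\<alpha> \<beta> bs. \<alpha> \<in> {0,1::nat} \<Longrightarrow> \<beta> \<in> {0,1::nat} \<Longrightarrow> bs \<noteq> [] \<Longrightarrow>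
      F (indet ^ \<alpha> * alt_word bs * indet ^ \<beta>) = G (indet ^ \<alpha> * alt_word bs * indet ^ \<beta>)"
  shows "F x = G x"
proof -
  have "cfunctional (\<lambda>x. F x - G x)"
    by (rule cfunctionalI) (simp_all add: cfunctionalD[OF F] cfunctionalD[OF G] algebra_simps)
  from functional_zero_if_zero_on_words[OF this] assms(3,4) show ?thesis by simp
qed

lemma alt_word_append:
  "as \<noteq> [] \<Longrightarrow> bs \<noteq> [] \<Longrightarrow> alt_word (as @ bs) = alt_word as * indet * alt_word bs"
  by (induction as rule: alt_word.induct) (simp_all add: alt_word_Cons mult.assoc)

lemma indet_power_absorb: "\<alpha> \<in> {0,1::nat} \<Longrightarrow> indet * indet ^ \<alpha> = indet"
  "\<alpha> \<in> {0,1::nat} \<Longrightarrow> indet ^ \<alpha> * indet = indet"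
  by (auto simp: indet_idem)

text \<open>On two words joined by the indeterminate, splitting is the multiplicativity of
  \<open>\<Prod>b\<leftarrow>bs. \<phi> b\<close> under concatenation. Both sides are linear in either argument, so it
  propagates from words to the second argument and then to the first.\<close>

lemma splits_at_ext_state:
  assumes "is_state \<phi>"
  shows "splits_at (ext_state \<phi>) indet"
proof -
  let ?F = "ext_state \<phi>"
  have "extends_state \<phi> ?F" using assms by (rule ext_state_extends)
  then have F_word: "?F (indet ^ \<alpha> * alt_word bs * indet ^ \<beta>) = (\<Prod>b\<leftarrow>bs. \<phi> b)"
    if "\<alpha> \<in> {0,1::nat}" "\<beta> \<in> {0,1::nat}" "bs \<noteq> []" for \<alpha> \<beta> bs
    using that unfolding extends_state_def by blast
  note F = cfunctional_ext_state[OF assms] and F_indet = ext_state_indet[OF assms]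
  note lin = cfunctionalD[OF F]
  have right: "cfunctional (\<lambda>y. ?F (x * y))" "cfunctional (\<lambda>y. ?F x * ?F y)" for x
    by (rule cfunctionalI; simp add: lin distrib_left mult_scaleC_right algebra_simps)+
  have left: "cfunctional (\<lambda>x. ?F (x * y))" "cfunctional (\<lambda>x. ?F x * ?F y)" for y
    by (rule cfunctionalI; simp add: lin distrib_right mult_scaleC_left algebra_simps)+
  have indet_left: "?F (indet * y) = ?F y" for y
  proof (rule functional_eq_if_eq_on_words[OF right(1) F])
    show "?F (indet * indet) = ?F indet" by (simp add: indet_idem)
  next
    fix \<alpha> \<beta> :: nat and bs :: "'a list"
    assume *: "\<alpha> \<in> {0,1}" "\<beta> \<in> {0,1}" "bs \<noteq> []"
    then have "indet * (indet ^ \<alpha> * alt_word bs * indet ^ \<beta>)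
        = indet ^ 1 * alt_word bs * indet ^ \<beta>"
      by (simp add: indet_power_absorb flip: mult.assoc)
    then show "?F (indet * (indet ^ \<alpha> * alt_word bs * indet ^ \<beta>))
        = ?F (indet ^ \<alpha> * alt_word bs * indet ^ \<beta>)"
      using F_word[of 1 \<beta> bs] F_word[of \<alpha> \<beta> bs] * by simp
  qed
  have word_left: "?F (indet ^ \<alpha> * alt_word as * indet ^ \<beta> * indet * y)
      = ?F (indet ^ \<alpha> * alt_word as * indet ^ \<beta>) * ?F y"
    if as: "\<alpha> \<in> {0,1::nat}" "\<beta> \<in> {0,1::nat}" "as \<noteq> []" for \<alpha> \<beta> as y
  proof (rule functional_eq_if_eq_on_words[OF right])
    have "indet ^ \<alpha> * alt_word as * indet ^ \<beta> * indet * indet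
        = indet ^ \<alpha> * alt_word as * indet ^ 1"
      using as by (simp add: mult.assoc indet_power_absorb indet_idem)
    then show "?F (indet ^ \<alpha> * alt_word as * indet ^ \<beta> * indet * indet)
        = ?F (indet ^ \<alpha> * alt_word as * indet ^ \<beta>) * ?F indet"
      using F_word[of \<alpha> 1 as] F_word[of \<alpha> \<beta> as] as by (simp add: F_indet)
  next
    fix \<gamma> \<delta> :: nat and bs :: "'a list"
    assume bs: "\<gamma> \<in> {0,1}" "\<delta> \<in> {0,1}" "bs \<noteq> []"
    have "indet ^ \<alpha> * alt_word as * indet ^ \<beta> * indet * (indet ^ \<gamma> * alt_word bs * indet ^ \<delta>)
        = indet ^ \<alpha> * alt_word as * (indet ^ \<beta> * indet * indet ^ \<gamma>) * alt_word bs * indet ^ \<delta>"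
      by (simp only: mult.assoc)
    also have "\<dots> = indet ^ \<alpha> * alt_word (as @ bs) * indet ^ \<delta>"
      using as bs by (simp only: indet_power_absorb alt_word_append mult.assoc not_False_eq_True)
    finally show "?F (indet ^ \<alpha> * alt_word as * indet ^ \<beta> * indet
          * (indet ^ \<gamma> * alt_word bs * indet ^ \<delta>))
        = ?F (indet ^ \<alpha> * alt_word as * indet ^ \<beta>) * ?F (indet ^ \<gamma> * alt_word bs * indet ^ \<delta>)"
      using F_word[of \<alpha> \<delta> "as @ bs"] F_word[of \<alpha> \<beta> as] F_word[of \<gamma> \<delta> bs] as bs by simp
  qed
  have "?F (x * (indet * y)) = ?F x * ?F y" for x y
  proof (rule functional_eq_if_eq_on_words[OF left])
    show "?F (indet * (indet * y)) = ?F indet * ?F y"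
      by (simp add: indet_left F_indet)
  qed (use word_left in \<open>simp add: mult.assoc\<close>)
  then show ?thesis by (simp add: splits_at_def mult.assoc)
qed

section \<open>Product functionals\<close>

lemma splits_at_tensor_functional:
  assumes f: "cfunctional f" and g: "cfunctional g"
    and p: "splits_at f p" and q: "splits_at g q"
  shows "splits_at (f \<otimes>\<^sub>f g) (p \<otimes> q)"
proof -
  note fg = tensor_functional[OF f g]
  have "(f \<otimes>\<^sub>f g) (x * (p \<otimes> q) * y) = (f \<otimes>\<^sub>f g) x * (f \<otimes>\<^sub>f g) y" for x y
  proof (induction x rule: tensor_induct)
    case (pure a b)
    show ?case
      by (induction y rule: tensor_induct)
        (simp_all add: fg(2) cfunctionalD[OF fg(1)] splits_atD[OF p] splits_atD[OF q]
          tensor_mult distrib_left mult_scaleC_right)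
  qed (simp_all add: cfunctionalD[OF fg(1)] distrib_right mult_scaleC_left)
  then show ?thesis by (simp add: splits_at_def)
qed

text \<open>Elements that are proportional under a functional in any surroundings may be exchanged leg by
  leg in a product functional. This lets a compressed block \<open>QbQ\<close> in one leg be replaced by a
  multiple of \<open>Q\<close> although the surroundings are not pure tensors.\<close>

lemma tensor_functional_exchange:
  assumes f: "cfunctional f" and g: "cfunctional g"
    and c: "\<And>x y. f (x * c * y) = r * f (x * d * y)"
    and c': "\<And>x y. g (x * c' * y) = s * g (x * d' * y)"
  shows "(f \<otimes>\<^sub>f g) (x * (c \<otimes> c') * y) = r * s * (f \<otimes>\<^sub>f g) (x * (d \<otimes> d') * y)"
proof -
  note fg = tensor_functional[OF f g]
  show ?thesis
  proof (induction x rule: tensor_induct)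
    case (pure a b)
    show ?case
      by (induction y rule: tensor_induct)
        (simp_all add: fg(2) cfunctionalD[OF fg(1)] c c'
          tensor_mult distrib_left mult_scaleC_right)
  qed (simp_all add: cfunctionalD[OF fg(1)] distrib_right distrib_left mult_scaleC_left)
qed

section \<open>The peak formula for products of three extended states\<close>

lemma product_state_is_state:
  assumes "is_state f\<^sub>1" and "is_state f\<^sub>2" and "is_state f\<^sub>3"
  shows "is_state (ext_state f\<^sub>1 \<otimes>\<^sub>f ext_state f\<^sub>2 \<otimes>\<^sub>f ext_state f\<^sub>3)"
  by (intro is_state_tensor_functional is_state_ext_state assms)

lemma product_state_first:
  assumes "is_state f\<^sub>1" and "is_state f\<^sub>2" and "is_state f\<^sub>3"
  shows "(ext_state f\<^sub>1 \<otimes>\<^sub>f ext_state f\<^sub>2 \<otimes>\<^sub>f ext_state f\<^sub>3) (emb a \<otimes> indet \<otimes> indet) = f\<^sub>1 a"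
  using assms
  by (simp add: tensor_functional cfunctional_ext_state ext_state_indet ext_state_emb)

text \<open>The hypotheses on \<open>x\<close> and \<open>y\<close> cover both shapes of the surroundings of a peak: the end of
  the word, or a neighbour in the first algebra, which absorbs \<open>E = 1 \<otimes> Q \<otimes> Q\<close>. Multiplying by
  \<open>\<omega> = P \<otimes> Q \<otimes> Q\<close> from outside, which \<open>F\<close> does not notice, reduces the first shape to the
  second, so that the middle factor can be compressed by \<open>E\<close>.\<close>

lemma product_state_peak:
  fixes f\<^sub>1 :: "'a::complex_algebra_1 \<Rightarrow> complex" and f\<^sub>2 f\<^sub>3 :: "'b::complex_algebra_1 \<Rightarrow> complex"
  assumes states: "is_state f\<^sub>1" "is_state f\<^sub>2" "is_state f\<^sub>3"
  defines "F \<equiv> ext_state f\<^sub>1 \<otimes>\<^sub>f ext_state f\<^sub>2 \<otimes>\<^sub>f ext_state f\<^sub>3"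
  assumes x: "x = 1 \<or> x * (1 \<otimes> indet \<otimes> indet) = x"
    and y: "y = 1 \<or> (1 \<otimes> indet \<otimes> indet) * y = y"
  shows "F (x * (indet \<otimes> emb b \<otimes> 1 + (1 - indet) \<otimes> 1 \<otimes> emb b) * y)
    = (f\<^sub>2 b - f\<^sub>3 b) * F x * F y + f\<^sub>3 b * F (x * y)"
proof -
  let ?P = "indet :: 'a extension" and ?Q = "indet :: 'b extension"
  let ?z = "?P \<otimes> emb b \<otimes> 1 + (1 - ?P) \<otimes> 1 \<otimes> emb b"
  define E where "E = (1 :: 'a extension) \<otimes> ?Q \<otimes> ?Q"
  define \<omega> where "\<omega> = ?P \<otimes> ?Q \<otimes> ?Q"
  have f\<^sub>1: "cfunctional (ext_state f\<^sub>1)" and f\<^sub>2: "cfunctional (ext_state f\<^sub>2)"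
    and f\<^sub>3: "cfunctional (ext_state f\<^sub>3)"
    by (simp_all add: cfunctional_ext_state states)
  have lin: "F (s + t) = F s + F t" "F (c *\<^sub>C s) = c * F s" and F_1: "F 1 = 1" for s t c
    using product_state_is_state[OF states] by (simp_all add: F_def is_state_def cfunctionalD)
  have split: "splits_at F \<omega>"
    unfolding F_def \<omega>_def
    by (intro splits_at_tensor_functional tensor_functional(1) splits_at_ext_state f\<^sub>1 f\<^sub>2 f\<^sub>3 states)
  define u where "u = \<omega> * x"
  define v where "v = y * \<omega>"
  have Fu: "F (u * s) = F (x * s)" and Fv: "F (s * v) = F (s * y)" for s
    using splits_at_absorb(1)[OF split F_1, of "x * s"] splits_at_absorb(2)[OF split F_1, of "s * y"]
    by (simp_all add: u_def v_def mult.assoc)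
  have \<omega>E: "\<omega> * E = \<omega>" "E * \<omega> = \<omega>"
    by (simp_all add: E_def \<omega>_def tensor_mult indet_idem)
  have uE: "u * E = u"
    using x unfolding u_def E_def[symmetric] by (auto simp: \<omega>E mult.assoc)
  have Ev: "E * v = v"
    using y unfolding v_def E_def[symmetric] by (auto simp: \<omega>E simp flip: mult.assoc)
  have compress: "E * ?z * E = ?P \<otimes> (?Q * emb b * ?Q) \<otimes> ?Q + (1 - ?P) \<otimes> ?Q \<otimes> (?Q * emb b * ?Q)"
    by (simp add: E_def tensor_mult indet_idem distrib_left distrib_right)
  have E_split: "E = \<omega> + (1 - ?P) \<otimes> ?Q \<otimes> ?Q"
    by (simp add: E_def \<omega>_def flip: tensor_add_left)
  have block: "ext_state f (s * (indet * emb b * indet) * t) = f b * ext_state f (s * indet * t)"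
    if "is_state f" for f and s t :: "'b extension"
    using that by (simp only: splits_at_sandwich[OF splits_at_ext_state] ext_state_emb)
  have second: "F (u * (?P \<otimes> (?Q * emb b * ?Q) \<otimes> ?Q) * v) = f\<^sub>2 b * F (u * \<omega> * v)"
  proof -
    have "(ext_state f\<^sub>1 \<otimes>\<^sub>f ext_state f\<^sub>2) (s * (?P \<otimes> (?Q * emb b * ?Q)) * t)
        = 1 * f\<^sub>2 b * (ext_state f\<^sub>1 \<otimes>\<^sub>f ext_state f\<^sub>2) (s * (?P \<otimes> ?Q) * t)" for s t
      by (rule tensor_functional_exchange[OF f\<^sub>1 f\<^sub>2]) (simp_all add: block states)
    then have "F (u * (?P \<otimes> (?Q * emb b * ?Q) \<otimes> ?Q) * v) = f\<^sub>2 b * 1 * F (u * \<omega> * v)"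
      unfolding F_def \<omega>_def
      by (intro tensor_functional_exchange tensor_functional(1) f\<^sub>1 f\<^sub>2 f\<^sub>3) simp_all
    then show ?thesis by simp
  qed
  have third: "F (u * ((1 - ?P) \<otimes> ?Q \<otimes> (?Q * emb b * ?Q)) * v)
      = f\<^sub>3 b * F (u * ((1 - ?P) \<otimes> ?Q \<otimes> ?Q) * v)"
  proof -
    have "F (u * ((1 - ?P) \<otimes> ?Q \<otimes> (?Q * emb b * ?Q)) * v)
        = 1 * f\<^sub>3 b * F (u * ((1 - ?P) \<otimes> ?Q \<otimes> ?Q) * v)"
      unfolding F_def
      by (intro tensor_functional_exchange tensor_functional(1) f\<^sub>1 f\<^sub>2 f\<^sub>3)
        (simp_all add: block states)
    then show ?thesis by simp
  qed
  have cut: "F (u * \<omega> * v) = F x * F y"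
    using splits_atD[OF split] Fu[of 1] Fv[of 1] by simp
  have delete: "F (u * E * v) = F (x * y)"
    by (simp add: uE Fu Fv)
  have "F (x * ?z * y) = F (u * ?z * v)"
    by (simp only: Fv) (simp only: mult.assoc Fu)
  also have "\<dots> = F (u * (E * ?z * E) * v)"
  proof -
    have "u * (E * ?z * E) * v = (u * E) * ?z * (E * v)" by (simp only: mult.assoc)
    then show ?thesis by (simp only: uE Ev)
  qed
  also have "\<dots> = f\<^sub>2 b * F (u * \<omega> * v) + f\<^sub>3 b * F (u * ((1 - ?P) \<otimes> ?Q \<otimes> ?Q) * v)"
    unfolding compress by (simp only: distrib_left distrib_right lin second third)
  also have "F (u * ((1 - ?P) \<otimes> ?Q \<otimes> ?Q) * v) = F (u * E * v) - F (u * \<omega> * v)"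
    by (simp add: E_split distrib_left distrib_right lin)
  finally have "F (x * ?z * y) = f\<^sub>2 b * (F x * F y) + f\<^sub>3 b * (F (x * y) - F x * F y)"
    by (simp only: cut delete)
  then show ?thesis by (simp only: algebra_simps)
qed

section \<open>Peaks in words over two algebras\<close>

lemma generated_subalgebra_range:
  assumes "alg_hom h"
  shows "generated_subalgebra (range h) = range h" and "subalgebra (range h)"
proof -
  interpret h: Vector_Spaces.linear scaleC scaleC h using assms by (simp add: alg_hom_def)
  have "h x * h y \<in> range h" for x y
    using assms by (metis alg_hom_def rangeI)
  then show sub: "subalgebra (range h)"
    unfolding subalgebra_def using h.subspace_image[OF calg.subspace_UNIV] by blast
  then show "generated_subalgebra (range h) = range h"
    unfolding generated_subalgebra_def by blast
qed

text \<open>With only two indices, a peak is the sole letter of the word or carries the upper index and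
  has lower neighbours. The element \<open>e\<close> acts as a unit on the lower algebra.\<close>

lemma peak_two_algebras:
  fixes B :: "nat \<Rightarrow> 'a::complex_algebra_1 set"
  assumes js: "set js \<subseteq> {1, 2}" and word: "list_all2 (\<lambda>j b. b \<in> B j) js bs" and peak: "peak js i"
    and e: "\<forall>a\<in>B 1. a * e = a \<and> e * a = a"
  obtains (single) "i = 0" "bs = [bs ! 0]"
  | (upper) "bs ! i \<in> B 2"
    "prod_list (take i bs) = 1 \<or> prod_list (take i bs) * e = prod_list (take i bs)"
    "prod_list (drop (i + 1) bs) = 1 \<or> e * prod_list (drop (i + 1) bs) = prod_list (drop (i + 1) bs)"
proof -
  have len: "length js = length bs" and i: "i < length js"
    using word peak by (auto simp: list_all2_lengthD peak_def)
  have mem: "bs ! k \<in> B (js ! k)" if "k < length js" for k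
    using list_all2_nthD[OF word that] .
  have two: "js ! k = 1 \<or> js ! k = 2" if "k < length js" for k
    using js nth_mem[OF that] by auto
  consider "js ! i = 1" | "js ! i = 2" using two[OF i] by blast
  then show thesis
  proof cases
    case 1
    have "i = 0"
    proof (rule ccontr)
      assume "i \<noteq> 0"
      then have "js ! (i - 1) < 1" using peak 1 by (simp add: peak_def)
      then show False using two[of "i - 1"] i by (auto simp: less_imp_diff_less)
    qed
    moreover have "length bs = 1"
    proof (rule ccontr)
      assume "length bs \<noteq> 1"
      then have l: "i + 1 < length js" using \<open>i = 0\<close> i len by linarith
      then have "js ! (i + 1) < 1" using peak 1 by (simp add: peak_def)
      then show False using two[OF l] by auto
    qed
    then have "bs = [bs ! 0]" by (cases bs) auto
    ultimately show thesis by (rule single)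
  next
    case 2
    show thesis
    proof (rule upper)
      show "bs ! i \<in> B 2" using mem[OF i] 2 by simp
    next
      show "prod_list (take i bs) = 1 \<or> prod_list (take i bs) * e = prod_list (take i bs)"
      proof (cases i)
        case (Suc k)
        then have "js ! k < 2" using peak 2 by (simp add: peak_def)
        then have "js ! k = 1" using two[of k] i Suc by auto
        then have "bs ! k * e = bs ! k" using mem[of k] e i Suc by simp
        moreover have "take i bs = take k bs @ [bs ! k]"
          using i len Suc by (simp add: take_Suc_conv_app_nth)
        ultimately show ?thesis by (simp add: mult.assoc)
      qed simp
    next
      show "prod_list (drop (i + 1) bs) = 1
          \<or> e * prod_list (drop (i + 1) bs) = prod_list (drop (i + 1) bs)"
      proof (cases "i + 1 < length js")
        case True
        then have "js ! (i + 1) < 2" using peak 2 by (simp add: peak_def)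
        then have "js ! (i + 1) = 1" using two[OF True] by auto
        then have "e * bs ! (i + 1) = bs ! (i + 1)" using mem[OF True] e by simp
        moreover have "drop (i + 1) bs = bs ! (i + 1) # drop (i + 2) bs"
          using True len by (simp add: Cons_nth_drop_Suc)
        ultimately show ?thesis by (simp flip: mult.assoc)
      qed (simp add: len)
    qed
  qed
qed

section \<open>The monotone and c-monotone embeddings\<close>

theorem proposition3p1:
  fixes \<phi>\<^sub>1 \<psi>\<^sub>1 :: "'a::complex_algebra_1 \<Rightarrow> complex"
    and \<phi>\<^sub>2 \<psi>\<^sub>2 :: "'b::complex_algebra_1 \<Rightarrow> complex"
    and P :: "'a extension" and Q :: "'b extension"
    and \<phi> \<psi> :: "(('a extension, 'b extension) tensor, 'b extension) tensor \<Rightarrow> complex"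
    and j\<^sub>1 :: "'a \<Rightarrow> (('a extension, 'b extension) tensor, 'b extension) tensor"
    and j\<^sub>2 :: "'b \<Rightarrow> (('a extension, 'b extension) tensor, 'b extension) tensor"
  assumes "is_state \<phi>\<^sub>1" and "is_state \<psi>\<^sub>1" and "is_state \<phi>\<^sub>2" and "is_state \<psi>\<^sub>2"
    and "P = indet" and "Q = indet"
    and "\<phi> = ext_state \<phi>\<^sub>1 \<otimes>\<^sub>f ext_state \<phi>\<^sub>2 \<otimes>\<^sub>f ext_state \<psi>\<^sub>2"
    and "\<psi> = ext_state \<psi>\<^sub>1 \<otimes>\<^sub>f ext_state \<psi>\<^sub>2 \<otimes>\<^sub>f ext_state \<psi>\<^sub>2"
    and "j\<^sub>1 = (\<lambda>a\<^sub>1. emb a\<^sub>1 \<otimes> Q \<otimes> Q)"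
    and "j\<^sub>2 = (\<lambda>a\<^sub>2. P \<otimes> emb a\<^sub>2 \<otimes> 1 + (1 - P) \<otimes> 1 \<otimes> emb a\<^sub>2)"
  shows "\<phi> \<circ> j\<^sub>1 = \<phi>\<^sub>1 \<and> \<phi> \<circ> j\<^sub>2 = \<phi>\<^sub>2 \<and> \<psi> \<circ> j\<^sub>1 = \<psi>\<^sub>1 \<and> \<psi> \<circ> j\<^sub>2 = \<psi>\<^sub>2 \<and>
    c_monotone_independent {1, 2 :: nat}
      (\<lambda>i. generated_subalgebra (if i = 1 then range j\<^sub>1 else range j\<^sub>2)) \<phi> \<psi>"
proof -
  define F where "F f\<^sub>1 f\<^sub>2 f\<^sub>3 = ext_state f\<^sub>1 \<otimes>\<^sub>f ext_state f\<^sub>2 \<otimes>\<^sub>f ext_state f\<^sub>3"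
    for f\<^sub>1 :: "'a \<Rightarrow> complex" and f\<^sub>2 f\<^sub>3 :: "'b \<Rightarrow> complex"
  define E where "E = (1 :: 'a extension) \<otimes> (indet :: 'b extension) \<otimes> (indet :: 'b extension)"
  let ?B = "\<lambda>i :: nat. generated_subalgebra (if i = 1 then range j\<^sub>1 else range j\<^sub>2)"
  note states = assms(1-4)
  have \<phi>: "\<phi> = F \<phi>\<^sub>1 \<phi>\<^sub>2 \<psi>\<^sub>2" and \<psi>: "\<psi> = F \<psi>\<^sub>1 \<psi>\<^sub>2 \<psi>\<^sub>2"
    using assms(7,8) by (simp_all add: F_def)
  have j\<^sub>1: "j\<^sub>1 a = emb a \<otimes> indet \<otimes> indet"
    and j\<^sub>2: "j\<^sub>2 b = indet \<otimes> emb b \<otimes> 1 + (1 - indet) \<otimes> 1 \<otimes> emb b" for a b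
    using assms(5,6,9,10) by simp_all
  have "alg_hom j\<^sub>1" "alg_hom j\<^sub>2"
    using alg_hom_first alg_hom_second assms(5,6,9,10) by auto
  note range_j = generated_subalgebra_range[OF this(1)] generated_subalgebra_range[OF this(2)]
  have E: "\<forall>a\<in>?B 1. a * E = a \<and> E * a = a"
    unfolding if_P[OF refl] range_j(1) by (auto simp: E_def j\<^sub>1 tensor_mult indet_idem)

  have F_1: "F f\<^sub>1 f\<^sub>2 f\<^sub>3 1 = 1" and F_j\<^sub>1: "F f\<^sub>1 f\<^sub>2 f\<^sub>3 (j\<^sub>1 a) = f\<^sub>1 a"
    if "is_state f\<^sub>1" "is_state f\<^sub>2" "is_state f\<^sub>3" for f\<^sub>1 f\<^sub>2 f\<^sub>3 a
    using product_state_is_state[OF that] product_state_first[OF that]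
    by (simp_all add: F_def is_state_def j\<^sub>1)
  have F_peak: "F f\<^sub>1 f\<^sub>2 f\<^sub>3 (x * j\<^sub>2 b * y)
      = (f\<^sub>2 b - f\<^sub>3 b) * F f\<^sub>1 f\<^sub>2 f\<^sub>3 x * F f\<^sub>1 f\<^sub>2 f\<^sub>3 y + f\<^sub>3 b * F f\<^sub>1 f\<^sub>2 f\<^sub>3 (x * y)"
    if "is_state f\<^sub>1" "is_state f\<^sub>2" "is_state f\<^sub>3" "x = 1 \<or> x * E = x" "y = 1 \<or> E * y = y"
    for f\<^sub>1 f\<^sub>2 f\<^sub>3 x y b
    using product_state_peak[OF that(1-3)] that(4,5) by (simp add: F_def j\<^sub>2 E_def)
  have F_j\<^sub>2: "F f\<^sub>1 f\<^sub>2 f\<^sub>3 (j\<^sub>2 b) = f\<^sub>2 b"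
    if "is_state f\<^sub>1" "is_state f\<^sub>2" "is_state f\<^sub>3" for f\<^sub>1 f\<^sub>2 f\<^sub>3 b
    using F_peak[OF that, of 1 1 b] F_1[OF that] by simp

  have marginals: "\<phi> (j\<^sub>1 a) = \<phi>\<^sub>1 a" "\<psi> (j\<^sub>1 a) = \<psi>\<^sub>1 a" "\<phi> (j\<^sub>2 b) = \<phi>\<^sub>2 b" "\<psi> (j\<^sub>2 b) = \<psi>\<^sub>2 b" for a b
    by (simp_all add: \<phi> \<psi> F_j\<^sub>1 F_j\<^sub>2 states)

  \<comment> \<open>One identity covers both functionals: for \<open>f\<^sub>1 = \<psi>\<^sub>1\<close> and \<open>f\<^sub>2 = \<psi>\<^sub>2\<close> the left factor of the
    cutting term is \<open>\<psi> - \<psi>\<close>.\<close>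
  have F_word: "F f\<^sub>1 f\<^sub>2 \<psi>\<^sub>2 (prod_list bs)
      = (F f\<^sub>1 f\<^sub>2 \<psi>\<^sub>2 (bs ! i) - \<psi> (bs ! i))
          * F f\<^sub>1 f\<^sub>2 \<psi>\<^sub>2 (prod_list (take i bs)) * F f\<^sub>1 f\<^sub>2 \<psi>\<^sub>2 (prod_list (drop (i + 1) bs))
        + \<psi> (bs ! i) * F f\<^sub>1 f\<^sub>2 \<psi>\<^sub>2 (prod_list (take i bs @ drop (i + 1) bs))"
    if word: "set js \<subseteq> {1, 2}" "list_all2 (\<lambda>j b. b \<in> ?B j) js bs" "peak js i"
      and f: "is_state f\<^sub>1" "is_state f\<^sub>2" for f\<^sub>1 f\<^sub>2 js bs i
    using word E
  proof (cases rule: peak_two_algebras)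
    case single
    then obtain b where "bs = [b]" by blast
    with \<open>i = 0\<close> show ?thesis by (simp add: F_1 f states)
  next
    case upper
    then obtain b where b: "bs ! i = j\<^sub>2 b" by (auto simp: range_j)
    have "i < length bs"
      using word by (auto simp: peak_def dest: list_all2_lengthD)
    then have "prod_list bs = prod_list (take i bs) * j\<^sub>2 b * prod_list (drop (i + 1) bs)"
      using id_take_nth_drop[of i bs] b
      by (metis Suc_eq_plus1 mult.assoc prod_list.Cons prod_list.append)
    then show ?thesis
      using F_peak[OF f states(4) upper(2,3), of b] by (simp add: b marginals F_j\<^sub>2 f states)
  qed
  have "monotone_independent {1, 2} ?B \<psi>"
    unfolding monotone_independent_def
    using F_word[OF _ _ _ states(2,4)] by (auto simp: \<psi>[symmetric] range_j)
  moreover have "c_monotone_independent {1, 2} ?B \<phi> \<psi>"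
    unfolding c_monotone_independent_def
    using calculation F_word[OF _ _ _ states(1,3)] by (auto simp: \<phi>[symmetric])
  ultimately show ?thesis
    by (simp add: fun_eq_iff marginals)
qed

end
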